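(* The map $\phi: g \mapsto \operatorname{Part} g$ is a bijection from the set of recursive normal permutations of $\mathbb{N}$ onto the set of decidable and permutable equivalence relations on $\mathbb{N}$.
   Context: $\operatorname{Part} g = \{[x]_g : x\in\mathbb{N}\}$ with $[x]_g=\{g^k(x):k\in\mathbb{Z}\}$, viewed as an equivalence relation. An equivalence relation $\Pi$ on $\mathbb{N}$ is decidable if membership of pairs in it is decidable, and permutable if there exists a recursive permutation $f$ with $\operatorname{Part} f = \Pi$. Let $\delta:\mathbb{Z}\to\mathbb{N}$, $\delta(0)=0$, $\delta(k)=2k$ ($k>0$), $\delta(k)=-2k-1$ ($k<0$). A cycle of $g$ of length $n\in\mathbb{N}^+\cup\{\infty\}$ with least element $a_0$ is in normal form if $j\mapsto g^{\delta^{-1}(j)}(a_0)$ is strictly increasing for $0\le j<n$; $g$ is normal if all its cycles are in normal form. *)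

theory Defs
  imports "HOL-Library.Extended_Nat" "HOL-Library.Nat_Bijection"
begin

section \<open>Recursive functions\<close>

datatype recf =
    Zero
  | Succ
  | Proj nat
  | Comp recf "recf list"
  | Prec recf recf
  | Mu recf

text \<open>
  \<open>reval e xs y\<close> means that the partial recursive function described by \<open>e\<close> is defined on
  the argument list \<open>xs\<close>, with value \<open>y\<close>. A description carries no arity; for each length
  of the argument list it describes a partial function of that arity (which may be nowhere
  defined). Recursion and minimisation act on the first argument. In \<open>Mu\<close>, all values before
  the first zero have to be defined, so this is the partial minimisation operator.
\<close>

inductive reval :: "recf \<Rightarrow> nat list \<Rightarrow> nat \<Rightarrow> bool" where
  reval_Zero: "reval Zero xs 0"
| reval_Succ: "reval Succ [x] (Suc x)"
| reval_Proj: "i < length xs \<Longrightarrow> reval (Proj i) xs (xs ! i)"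
| reval_Comp: "list_all2 (\<lambda>g y. reval g xs y) gs ys \<Longrightarrow> reval f ys z \<Longrightarrow> reval (Comp f gs) xs z"
| reval_Prec_0: "reval f xs y \<Longrightarrow> reval (Prec f g) (0 # xs) y"
| reval_Prec_Suc: "reval (Prec f g) (n # xs) r \<Longrightarrow> reval g (n # r # xs) y
    \<Longrightarrow> reval (Prec f g) (Suc n # xs) y"
| reval_Mu: "reval f (n # xs) 0 \<Longrightarrow> (\<forall>m<n. \<exists>y. reval f (m # xs) (Suc y)) \<Longrightarrow> reval (Mu f) xs n"

lemma reval_functional: "reval e xs y \<Longrightarrow> reval e xs z \<Longrightarrow> y = z"
proof (induction arbitrary: z rule: reval.induct)
  case (reval_Zero xs)
  then show ?case by (auto elim: reval.cases)
next
  case (reval_Succ x)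
  then show ?case by (auto elim: reval.cases)
next
  case (reval_Proj i xs)
  from reval_Proj.prems show ?case by (auto elim: reval.cases)
next
  case (reval_Comp xs gs ys f w)
  from reval_Comp.prems obtain ys' where
    ys': "list_all2 (\<lambda>g y. reval g xs y) gs ys'" "reval f ys' z"
    by (auto elim: reval.cases)
  have "ys = ys'"
    using reval_Comp.IH(1) ys'(1) by (auto simp: list_all2_conv_all_nth intro!: nth_equalityI)
  then show ?case using reval_Comp.IH(2) ys'(2) by blast
next
  case (reval_Prec_0 f xs y g)
  from reval_Prec_0.prems have "reval f xs z" by (auto elim: reval.cases)
  then show ?case by (rule reval_Prec_0.IH)
next
  case (reval_Prec_Suc f g n xs r y)
  from reval_Prec_Suc.prems obtain r' where
    "reval (Prec f g) (n # xs) r'" "reval g (n # r' # xs) z"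
    by (auto elim: reval.cases)
  then show ?case using reval_Prec_Suc.IH by blast
next
  case (reval_Mu f n xs)
  from reval_Mu.prems have z: "reval f (z # xs) 0" "\<forall>m<z. \<exists>y. reval f (m # xs) (Suc y)"
    by (auto elim: reval.cases)
  have "\<not> n < z" using z(2) reval_Mu.IH(1) by fastforce
  moreover have "\<not> z < n" using z(1) reval_Mu.IH(2) by fastforce
  ultimately show ?case by simp
qed

definition recursive :: "(nat \<Rightarrow> nat) \<Rightarrow> bool" where
  "recursive f \<longleftrightarrow> (\<exists>e. \<forall>x. reval e [x] (f x))"

definition decidable_rel :: "(nat \<times> nat) set \<Rightarrow> bool" where
  "decidable_rel R \<longleftrightarrow> (\<exists>e. \<forall>x y. reval e [x, y] (if (x, y) \<in> R then 1 else 0))"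


section \<open>Cycles of permutations\<close>

text \<open>The integer power \<open>g\<^sup>k\<close>; it is only meaningful when \<open>g\<close> is a bijection.\<close>

definition perm_pow :: "('a \<Rightarrow> 'a) \<Rightarrow> int \<Rightarrow> 'a \<Rightarrow> 'a" where
  "perm_pow g k = (if 0 \<le> k then g ^^ nat k else inv g ^^ nat (- k))"

definition cycle_of :: "(nat \<Rightarrow> nat) \<Rightarrow> nat \<Rightarrow> nat set" where
  "cycle_of g x = {perm_pow g k x | k :: int. True}"

definition Part :: "(nat \<Rightarrow> nat) \<Rightarrow> nat set set" where
  "Part g = {cycle_of g x | x. True}"

definition Part_rel :: "(nat \<Rightarrow> nat) \<Rightarrow> (nat \<times> nat) set" where
  "Part_rel g = {(x, y). \<exists>C \<in> Part g. x \<in> C \<and> y \<in> C}"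

definition permutable :: "(nat \<times> nat) set \<Rightarrow> bool" where
  "permutable R \<longleftrightarrow> (\<exists>f. bij f \<and> recursive f \<and> Part_rel f = R)"


section \<open>Normal form\<close>

definition delta :: "int \<Rightarrow> nat" where
  "delta k = (if k = 0 then 0 else if k > 0 then nat (2 * k) else nat (- 2 * k - 1))"

lemma delta_eq_int_encode: "delta = int_encode"
  by (auto simp: fun_eq_iff delta_def int_encode_def sum_encode_def)

lemma bij_delta: "bij delta"
  unfolding delta_eq_int_encode by (rule bij_int_encode)

definition cycle_length :: "nat set \<Rightarrow> enat" where
  "cycle_length C = (if finite C then enat (card C) else \<infinity>)"

definition cycle_normal :: "(nat \<Rightarrow> nat) \<Rightarrow> nat set \<Rightarrow> bool" where
  "cycle_normal g C \<longleftrightarrow>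
     (let a0 = (LEAST a. a \<in> C)
      in strict_mono_on {j. enat j < cycle_length C} (\<lambda>j. perm_pow g (inv delta j) a0))"

definition normal :: "(nat \<Rightarrow> nat) \<Rightarrow> bool" where
  "normal g \<longleftrightarrow> (\<forall>C \<in> Part g. cycle_normal g C)"

end

(*
  A normal permutation is determined by its cycles: if c_0 < c_1 < ... are the elements of a
  cycle, normality forces g^k(c_0) = c_(delta k). Since j <= c_j, two elements x, y of a cycle are
  joined by a power g^k with |k| <= x + y, so membership of (x, y) is decided by a bounded search.
  Conversely, every equivalence relation has a unique normal permutation. Computing its value at x
  requires the class of x only up to the next two elements, or all of it if there are fewer; the
  latter alternative is recognised by following the cycle of x under any recursive permutation
  with the same cycles until it closes up.
*)

theory Submission
  imports Defs
begin

section \<open>Closure properties of total recursive functions\<close>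

text \<open>Arguments form one list of fixed length, so the closure rules apply to expressions in
  \<open>hd xs\<close>, \<open>hd (tl xs)\<close> and so on, and chain backwards by
  \<open>intro\<close>.\<close>

definition rec_fn :: "nat \<Rightarrow> (nat list \<Rightarrow> nat) \<Rightarrow> bool" where
  "rec_fn n F \<longleftrightarrow> (\<exists>e. \<forall>xs. length xs = n \<longrightarrow> reval e xs (F xs))"

definition rec_pred :: "nat \<Rightarrow> (nat list \<Rightarrow> bool) \<Rightarrow> bool" where
  "rec_pred n P \<longleftrightarrow> rec_fn n (\<lambda>xs. of_bool (P xs))"

lemma rec_fn_cong:
  assumes "rec_fn n F" "\<And>xs. length xs = n \<Longrightarrow> F xs = G xs"
  shows "rec_fn n G"
  using assms unfolding rec_fn_def by metis

lemma rec_pred_cong: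
  assumes "rec_pred n P" "\<And>xs. length xs = n \<Longrightarrow> P xs \<longleftrightarrow> Q xs"
  shows "rec_pred n Q"
  using assms unfolding rec_pred_def by (auto elim: rec_fn_cong)

lemma rec_fn_nth: "i < n \<Longrightarrow> rec_fn n (\<lambda>xs. xs ! i)"
  unfolding rec_fn_def by (metis reval_Proj)

lemma rec_fn_compose:
  assumes F: "rec_fn (length Gs) F" and Gs: "\<And>G. G \<in> set Gs \<Longrightarrow> rec_fn n G"
  shows "rec_fn n (\<lambda>xs. F (map (\<lambda>G. G xs) Gs))"
proof -
  obtain e where e: "\<And>xs. length xs = length Gs \<Longrightarrow> reval e xs (F xs)"
    using F unfolding rec_fn_def by blast
  have "\<forall>G\<in>set Gs. \<exists>d. \<forall>xs. length xs = n \<longrightarrow> reval d xs (G xs)"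
    using Gs unfolding rec_fn_def by blast
  then obtain d where d: "\<And>G xs. G \<in> set Gs \<Longrightarrow> length xs = n \<Longrightarrow> reval (d G) xs (G xs)"
    by metis
  have "reval (Comp e (map d Gs)) xs (F (map (\<lambda>G. G xs) Gs))" if "length xs = n" for xs
  proof (rule reval_Comp)
    show "list_all2 (\<lambda>g. reval g xs) (map d Gs) (map (\<lambda>G. G xs) Gs)"
      using d that by (auto simp: list_all2_conv_all_nth)
  qed (simp add: e)
  then show ?thesis unfolding rec_fn_def by blast
qed

lemma rec_fn_compose1:
  assumes "rec_fn (Suc 0) (\<lambda>xs. f (hd xs))" "rec_fn n A"
  shows "rec_fn n (\<lambda>xs. f (A xs))"
  using rec_fn_compose[of "[A]" "\<lambda>xs. f (hd xs)" n] assms by simp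

lemma rec_fn_compose2:
  assumes "rec_fn (Suc (Suc 0)) (\<lambda>xs. f (hd xs) (hd (tl xs)))" "rec_fn n A" "rec_fn n B"
  shows "rec_fn n (\<lambda>xs. f (A xs) (B xs))"
  using rec_fn_compose[of "[A, B]" "\<lambda>xs. f (hd xs) (hd (tl xs))" n] assms by auto

lemma rec_fn_Suc:
  assumes "rec_fn n A"
  shows "rec_fn n (\<lambda>xs. Suc (A xs))"
proof (rule rec_fn_compose1[where f=Suc, OF _ assms])
  show "rec_fn (Suc 0) (\<lambda>xs. Suc (hd xs))"
    unfolding rec_fn_def by (auto simp: length_Suc_conv intro!: exI[of _ Succ] reval_Succ)
qed

lemma rec_fn_const: "rec_fn n (\<lambda>xs. c)"
proof (induction c)
  case 0
  show ?case unfolding rec_fn_def using reval_Zero by blast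
qed (auto intro: rec_fn_Suc)

lemma rec_fn_var0: "rec_fn (Suc n) (\<lambda>xs. hd xs)"
  by (rule rec_fn_cong[OF rec_fn_nth[of 0]]) (auto simp: length_Suc_conv)

lemma rec_fn_var1: "rec_fn (Suc (Suc n)) (\<lambda>xs. hd (tl xs))"
  by (rule rec_fn_cong[OF rec_fn_nth[of 1]]) (auto simp: length_Suc_conv)

lemma rec_fn_var2: "rec_fn (Suc (Suc (Suc n))) (\<lambda>xs. hd (tl (tl xs)))"
  by (rule rec_fn_cong[OF rec_fn_nth[of 2]]) (auto simp: length_Suc_conv)

lemma rec_fn_var3: "rec_fn (Suc (Suc (Suc (Suc n)))) (\<lambda>xs. hd (tl (tl (tl xs))))"
  by (rule rec_fn_cong[OF rec_fn_nth[of 3]]) (auto simp: length_Suc_conv)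

text \<open>Inserts a dummy argument in second position, where primitive recursion puts the
  accumulator; \<open>rec_fn_sum\<close> relies on this.\<close>

lemma rec_fn_weaken:
  assumes "rec_fn (Suc n) (\<lambda>xs. F (hd xs) (tl xs))"
  shows "rec_fn (Suc (Suc n)) (\<lambda>xs. F (hd xs) (tl (tl xs)))"
proof -
  let ?Gs = "(\<lambda>xs. xs ! 0) # map (\<lambda>i xs. xs ! Suc (Suc i)) [0..<n]"
  have "rec_fn (Suc (Suc n)) (\<lambda>xs. (\<lambda>xs. F (hd xs) (tl xs)) (map (\<lambda>G. G xs) ?Gs))"
    by (rule rec_fn_compose) (use assms in \<open>auto intro: rec_fn_nth\<close>)
  then show ?thesis
  proof (rule rec_fn_cong)
    fix xs :: "nat list" assume "length xs = Suc (Suc n)"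
    then obtain a b ys where "xs = a # b # ys" "length ys = n"
      by (auto simp: length_Suc_conv)
    then show "F (hd (map (\<lambda>G. G xs) ?Gs)) (tl (map (\<lambda>G. G xs) ?Gs)) = F (hd xs) (tl (tl xs))"
      using map_nth[of ys] by (simp add: comp_def)
  qed
qed

text \<open>\<open>Prec\<close> recurses on its first argument, so the recursion is built with a
  free counter in front of the parameters and then composed with \<open>B\<close> for the counter
  and projections for the parameters.\<close>

lemma rec_fn_rec_nat:
  assumes A: "rec_fn n A" and B: "rec_fn n B"
    and G: "rec_fn (Suc (Suc n)) (\<lambda>xs. G (hd xs) (hd (tl xs)) (tl (tl xs)))"
  shows "rec_fn n (\<lambda>xs. rec_nat (A xs) (\<lambda>k r. G k r xs) (B xs))"
proof -
  let ?H = "\<lambda>k xs. rec_nat (A xs) (\<lambda>k r. G k r xs) k"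
  obtain e where e: "\<And>xs. length xs = n \<Longrightarrow> reval e xs (A xs)"
    using A unfolding rec_fn_def by blast
  obtain d where d: "\<And>xs. length xs = Suc (Suc n) \<Longrightarrow> reval d xs (G (hd xs) (hd (tl xs)) (tl (tl xs)))"
    using G unfolding rec_fn_def by blast
  have "reval (Prec e d) (k # xs) (?H k xs)" if "length xs = n" for k xs
  proof (induction k)
    case 0
    then show ?case using e[OF that] by (auto intro: reval_Prec_0)
  next
    case (Suc k)
    then show ?case using d[of "k # ?H k xs # xs"] that by (auto intro: reval_Prec_Suc)
  qed
  then have "\<forall>ys. length ys = Suc n \<longrightarrow> reval (Prec e d) ys (?H (hd ys) (tl ys))"
    by (auto simp: length_Suc_conv)
  then have H: "rec_fn (Suc n) (\<lambda>ys. ?H (hd ys) (tl ys))"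
    unfolding rec_fn_def by (rule exI)
  let ?Gs = "B # map (\<lambda>i xs. xs ! i) [0..<n]"
  have "rec_fn n (\<lambda>xs. (\<lambda>ys. ?H (hd ys) (tl ys)) (map (\<lambda>G. G xs) ?Gs))"
    by (rule rec_fn_compose) (use H B in \<open>auto intro: rec_fn_nth\<close>)
  then show ?thesis
  proof (rule rec_fn_cong)
    fix xs :: "nat list" assume "length xs = n"
    then have "map (\<lambda>G. G xs) ?Gs = B xs # xs"
      using map_nth[of xs] by (simp add: comp_def)
    then show "?H (hd (map (\<lambda>G. G xs) ?Gs)) (tl (map (\<lambda>G. G xs) ?Gs)) = ?H (B xs) xs"
      by simp
  qed
qed

lemma rec_fn_funpow:
  assumes "rec_fn (Suc 0) (\<lambda>xs. f (hd xs))" "rec_fn n A" "rec_fn n B"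
  shows "rec_fn n (\<lambda>xs. (f ^^ A xs) (B xs))"
proof -
  have "rec_fn n (\<lambda>xs. rec_nat (B xs) (\<lambda>k r. f r) (A xs))"
    by (intro rec_fn_rec_nat rec_fn_compose1[OF assms(1)] rec_fn_var1 assms)
  moreover have "rec_nat b (\<lambda>k r. f r) a = (f ^^ a) b" for a b
    by (induction a) auto
  ultimately show ?thesis by simp
qed

lemma rec_fn_add:
  assumes "rec_fn n A" "rec_fn n B"
  shows "rec_fn n (\<lambda>xs. A xs + B xs)"
proof -
  have "rec_fn n (\<lambda>xs. (Suc ^^ A xs) (B xs))"
    by (intro rec_fn_funpow rec_fn_Suc rec_fn_var0 assms)
  then show ?thesis by simp
qed

lemma rec_fn_diff:
  assumes "rec_fn n A" "rec_fn n B"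
  shows "rec_fn n (\<lambda>xs. A xs - B xs)"
proof -
  \<comment> \<open>Truncated predecessor: the recursion ignores its accumulator and returns the
    counter. Subtraction iterates it.\<close>
  have "rec_fn (Suc 0) (\<lambda>xs. rec_nat 0 (\<lambda>k r. k) (hd xs))"
    by (intro rec_fn_rec_nat rec_fn_const rec_fn_var0)
  moreover have "rec_nat 0 (\<lambda>k r. k) m = m - 1" for m :: nat
    by (cases m) auto
  ultimately have "rec_fn (Suc 0) (\<lambda>xs. hd xs - 1)" by simp
  then have "rec_fn n (\<lambda>xs. ((\<lambda>m. m - 1) ^^ B xs) (A xs))"
    by (rule rec_fn_funpow[OF _ assms(2,1)])
  moreover have "((\<lambda>m. m - 1) ^^ b) a = a - b" for a b :: nat
    by (induction b) auto
  ultimately show ?thesis by simp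
qed

lemma rec_fn_tl:
  assumes "rec_fn n A"
  shows "rec_fn (Suc n) (\<lambda>xs. A (tl xs))"
proof -
  let ?Gs = "map (\<lambda>i xs. xs ! Suc i) [0..<n]"
  have "rec_fn (Suc n) (\<lambda>xs. A (map (\<lambda>G. G xs) ?Gs))"
    by (rule rec_fn_compose) (use assms in \<open>auto intro: rec_fn_nth\<close>)
  then show ?thesis
  proof (rule rec_fn_cong)
    fix xs :: "nat list" assume "length xs = Suc n"
    then obtain a ys where "xs = a # ys" "length ys = n"
      by (auto simp: length_Suc_conv)
    then show "A (map (\<lambda>G. G xs) ?Gs) = A (tl xs)"
      using map_nth[of ys] by (simp add: comp_def)
  qed
qed

text \<open>Recursion on the truth value: zero steps return \<open>B\<close>, one step returns
  \<open>A\<close>, lifted past counter and accumulator.\<close>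

lemma rec_fn_if:
  assumes P: "rec_pred n P" and A: "rec_fn n A" and B: "rec_fn n B"
  shows "rec_fn n (\<lambda>xs. if P xs then A xs else B xs)"
proof -
  have "rec_fn n (\<lambda>xs. rec_nat (B xs) (\<lambda>k r. A xs) (of_bool (P xs)))"
    by (rule rec_fn_rec_nat[OF B P[unfolded rec_pred_def] rec_fn_tl[OF rec_fn_tl[OF A]]])
  then show ?thesis by (rule rec_fn_cong) simp
qed

lemma rec_pred_le:
  assumes "rec_fn n A" "rec_fn n B"
  shows "rec_pred n (\<lambda>xs. A xs \<le> B xs)"
proof -
  have "rec_fn n (\<lambda>xs. 1 - (A xs - B xs))"
    by (intro rec_fn_diff rec_fn_const assms)
  then show ?thesis unfolding rec_pred_def by (rule rec_fn_cong) auto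
qed

lemma rec_pred_less:
  assumes "rec_fn n A" "rec_fn n B"
  shows "rec_pred n (\<lambda>xs. A xs < B xs)"
  using rec_pred_le[OF rec_fn_Suc[OF assms(1)] assms(2)] by (simp add: Suc_le_eq)

lemma rec_pred_conj:
  assumes "rec_pred n P" "rec_pred n Q"
  shows "rec_pred n (\<lambda>xs. P xs \<and> Q xs)"
  using rec_fn_if[OF assms(1) assms(2)[unfolded rec_pred_def] rec_fn_const[of _ 0]]
  unfolding rec_pred_def by (rule rec_fn_cong) auto

lemma rec_pred_not:
  assumes "rec_pred n P"
  shows "rec_pred n (\<lambda>xs. \<not> P xs)"
  using rec_fn_if[OF assms rec_fn_const[of _ 0] rec_fn_const[of _ 1]]
  unfolding rec_pred_def by (rule rec_fn_cong) auto

lemma rec_pred_disj: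
  assumes "rec_pred n P" "rec_pred n Q"
  shows "rec_pred n (\<lambda>xs. P xs \<or> Q xs)"
  using rec_fn_if[OF assms(1) rec_fn_const[of _ 1] assms(2)[unfolded rec_pred_def]]
  unfolding rec_pred_def by (rule rec_fn_cong) auto

lemma rec_pred_eq:
  assumes "rec_fn n A" "rec_fn n B"
  shows "rec_pred n (\<lambda>xs. A xs = B xs)"
  using rec_pred_conj[OF rec_pred_le[OF assms] rec_pred_le[OF assms(2,1)]]
  by (rule rec_pred_cong) auto

lemma rec_fn_sum:
  assumes "rec_fn n B" "rec_fn (Suc n) (\<lambda>xs. F (hd xs) (tl xs))"
  shows "rec_fn n (\<lambda>xs. \<Sum>k<B xs. F k xs)"
proof -
  have "rec_fn n (\<lambda>xs. rec_nat 0 (\<lambda>k r. r + F k xs) (B xs))"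
    by (intro rec_fn_rec_nat rec_fn_const rec_fn_add rec_fn_var1 assms rec_fn_weaken)
  moreover have "rec_nat 0 (\<lambda>k r. r + F k xs) b = (\<Sum>k<b. F k xs)" for b xs
    by (induction b) auto
  ultimately show ?thesis by simp
qed

lemma rec_fn_card:
  assumes "rec_fn n B" "rec_pred (Suc n) (\<lambda>xs. P (hd xs) (tl xs))"
  shows "rec_fn n (\<lambda>xs. card {k. k < B xs \<and> P k xs})"
proof -
  have "rec_fn n (\<lambda>xs. \<Sum>k<B xs. of_bool (P k xs))"
    by (rule rec_fn_sum) (use assms in \<open>auto simp: rec_pred_def\<close>)
  moreover have "(\<Sum>k<b. of_bool (P k xs)) = card {k. k < b \<and> P k xs}" for b xs
    by (simp add: of_bool_def sum.If_cases Int_def)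
  ultimately show ?thesis by simp
qed

text \<open>A bounded search succeeds iff the number of witnesses is positive, and that number is
  recursive as a sum of indicator values.\<close>

lemma rec_pred_bex:
  assumes "rec_fn n B" "rec_pred (Suc n) (\<lambda>xs. P (hd xs) (tl xs))"
  shows "rec_pred n (\<lambda>xs. \<exists>k<B xs. P k xs)"
  using rec_pred_less[OF rec_fn_const[of _ 0] rec_fn_card[OF assms]]
  by (rule rec_pred_cong) (auto simp: card_gt_0_iff)

lemma rec_pred_ball:
  assumes "rec_fn n B" "rec_pred (Suc n) (\<lambda>xs. P (hd xs) (tl xs))"
  shows "rec_pred n (\<lambda>xs. \<forall>k<B xs. P k xs)"
  using rec_pred_not[OF rec_pred_bex[OF assms(1) rec_pred_not[OF assms(2)]]]
  by (rule rec_pred_cong) auto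

lemma rec_pred_odd:
  assumes "rec_fn n A"
  shows "rec_pred n (\<lambda>xs. odd (A xs))"
proof -
  have "rec_fn n (\<lambda>xs. ((\<lambda>r. 1 - r) ^^ A xs) 0)"
    by (intro rec_fn_funpow rec_fn_diff rec_fn_const rec_fn_var0 assms)
  moreover have "((\<lambda>r. 1 - r) ^^ a) (0::nat) = of_bool (odd a)" for a
    by (induction a) auto
  ultimately show ?thesis unfolding rec_pred_def by simp
qed

text \<open>\<open>Mu\<close> looks for a zero, so it runs on the indicator of the negation. This
  indicator is total and equals 1 before the least witness, as \<open>reval_Mu\<close>
  demands.\<close>

lemma rec_fn_Least:
  assumes P: "rec_pred (Suc n) (\<lambda>xs. P (hd xs) (tl xs))"
    and ex: "\<And>xs. length xs = n \<Longrightarrow> \<exists>k. P k xs"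
  shows "rec_fn n (\<lambda>xs. LEAST k. P k xs)"
proof -
  obtain e where e: "\<And>xs. length xs = Suc n \<Longrightarrow> reval e xs (of_bool (\<not> P (hd xs) (tl xs)))"
    using rec_pred_not[OF P] unfolding rec_pred_def rec_fn_def by blast
  have "reval (Mu e) xs (LEAST k. P k xs)" if len: "length xs = n" for xs
  proof (rule reval_Mu)
    have e': "reval e (k # xs) (of_bool (\<not> P k xs))" for k
      using e[of "k # xs"] len by simp
    show "reval e ((LEAST k. P k xs) # xs) 0"
      using e'[of "LEAST k. P k xs"] LeastI_ex[OF ex[OF len]] by simp
    show "\<forall>m<LEAST k. P k xs. \<exists>y. reval e (m # xs) (Suc y)"
    proof (intro allI impI exI)
      fix m assume "m < (LEAST k. P k xs)"
      then have "\<not> P m xs" by (rule not_less_Least)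
      then show "reval e (m # xs) (Suc 0)" using e'[of m] by simp
    qed
  qed
  then show ?thesis unfolding rec_fn_def by blast
qed

lemma recursive_iff_rec_fn: "recursive f \<longleftrightarrow> rec_fn (Suc 0) (\<lambda>xs. f (hd xs))"
proof -
  have "(\<forall>x. reval e [x] (f x)) \<longleftrightarrow> (\<forall>xs. length xs = Suc 0 \<longrightarrow> reval e xs (f (hd xs)))" for e
    by (auto simp: length_Suc_conv)
  then show ?thesis unfolding recursive_def rec_fn_def by simp
qed

lemma decidable_rel_iff_rec_pred:
  "decidable_rel R \<longleftrightarrow> rec_pred (Suc (Suc 0)) (\<lambda>xs. (hd xs, hd (tl xs)) \<in> R)"
proof -
  have "(\<forall>x y. reval e [x, y] (if (x, y) \<in> R then 1 else 0)) \<longleftrightarrow>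
    (\<forall>xs. length xs = Suc (Suc 0) \<longrightarrow> reval e xs (of_bool ((hd xs, hd (tl xs)) \<in> R)))" for e
    by (auto simp: length_Suc_conv of_bool_def)
  then show ?thesis unfolding decidable_rel_def rec_pred_def rec_fn_def by simp
qed

lemma rec_pred_rel:
  assumes "decidable_rel R" "rec_fn n A" "rec_fn n B"
  shows "rec_pred n (\<lambda>xs. (A xs, B xs) \<in> R)"
  using rec_fn_compose2[where f="\<lambda>x y. of_bool ((x, y) \<in> R)"] assms
  unfolding decidable_rel_iff_rec_pred rec_pred_def by auto

section \<open>Powers and cycles of permutations\<close>

lemma perm_pow_Suc:
  assumes "bij g"
  shows "perm_pow g (k + 1) x = g (perm_pow g k x)"
proof (cases "k \<ge> 0")
  case True
  then show ?thesis by (simp add: perm_pow_def nat_add_distrib)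
next
  case False
  then have "nat (- k) = Suc (nat (- (k + 1)))" by simp
  then have "g (perm_pow g k x) = (inv g ^^ nat (- (k + 1))) x"
    using False assms by (simp add: perm_pow_def bij_is_surj surj_f_inv_f)
  \<comment> \<open>At \<open>k = -1\<close> the exponent moves from the \<open>inv g\<close> branch
    of \<open>perm_pow\<close> to the \<open>g\<close> branch; both are the identity at exponent
    0.\<close>
  moreover have "perm_pow g (k + 1) x = (inv g ^^ nat (- (k + 1))) x"
    using False by (cases "k = -1") (auto simp: perm_pow_def)
  ultimately show ?thesis by simp
qed

lemma perm_pow_0 [simp]: "perm_pow g 0 x = x"
  by (simp add: perm_pow_def)

lemma perm_pow_add:
  assumes "bij g"
  shows "perm_pow g (k + l) x = perm_pow g k (perm_pow g l x)"
proof (induction k rule: int_induct[where k = 0])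
  case base
  then show ?case by simp
next
  case (step1 k)
  have "perm_pow g (k + 1 + l) x = g (perm_pow g (k + l) x)"
    using perm_pow_Suc[OF assms, of "k + l"] by (simp add: add_ac)
  then show ?case using step1 perm_pow_Suc[OF assms] by simp
next
  case (step2 k)
  have "g (perm_pow g (k - 1 + l) x) = perm_pow g (k + l) x"
    using perm_pow_Suc[OF assms, of "k - 1 + l"] by (simp add: algebra_simps)
  also have "\<dots> = g (perm_pow g (k - 1) (perm_pow g l x))"
    using step2 perm_pow_Suc[OF assms, of "k - 1"] by simp
  finally show ?case using assms by (simp add: bij_is_inj inj_eq)
qed

lemma perm_pow_minus:
  assumes "bij g"
  shows "perm_pow g (- k) (perm_pow g k x) = x"
  using perm_pow_add[OF assms, of "- k" k x] by simp

lemma in_cycle_of_iff: "y \<in> cycle_of g x \<longleftrightarrow> (\<exists>k. y = perm_pow g k x)"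
  by (auto simp: cycle_of_def)

lemma self_in_cycle_of: "x \<in> cycle_of g x"
  unfolding in_cycle_of_iff by (metis perm_pow_0)

lemma funpow_in_cycle_of: "(g ^^ n) x \<in> cycle_of g x"
  unfolding in_cycle_of_iff by (rule exI[of _ "int n"]) (simp add: perm_pow_def)

lemma cycle_of_eq:
  assumes "bij g" "y \<in> cycle_of g x"
  shows "cycle_of g y = cycle_of g x"
proof -
  obtain k where k: "y = perm_pow g k x" using assms(2) in_cycle_of_iff by auto
  then have "x = perm_pow g (- k) y" using perm_pow_minus[OF assms(1)] by simp
  then show ?thesis
    using k perm_pow_add[OF assms(1)] unfolding set_eq_iff in_cycle_of_iff by metis
qed

lemma apply_in_cycle_of:
  assumes "bij g" "y \<in> cycle_of g x"
  shows "g y \<in> cycle_of g x"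
  using assms perm_pow_Suc[OF assms(1)] unfolding in_cycle_of_iff by metis

lemma Part_rel_iff:
  assumes "bij g"
  shows "(x, y) \<in> Part_rel g \<longleftrightarrow> y \<in> cycle_of g x"
proof
  assume "(x, y) \<in> Part_rel g"
  then obtain z where "x \<in> cycle_of g z" "y \<in> cycle_of g z"
    by (auto simp: Part_rel_def Part_def)
  then show "y \<in> cycle_of g x" using cycle_of_eq[OF assms] by simp
next
  assume "y \<in> cycle_of g x"
  then show "(x, y) \<in> Part_rel g"
    using self_in_cycle_of by (fastforce simp: Part_rel_def Part_def)
qed

lemma Part_rel_Image:
  assumes "bij g"
  shows "Part_rel g `` {x} = cycle_of g x"
  using Part_rel_iff[OF assms] by auto

lemma equiv_Part_rel:
  assumes "bij g"
  shows "equiv UNIV (Part_rel g)"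
proof (rule equivI)
  show "refl (Part_rel g)"
    by (simp add: refl_on_def Part_rel_iff[OF assms] self_in_cycle_of)
  show "sym (Part_rel g)" by (auto simp: sym_def Part_rel_def)
  show "trans (Part_rel g)"
    using cycle_of_eq[OF assms] by (auto simp: trans_def Part_rel_iff[OF assms])
qed simp

section \<open>Increasing enumerations\<close>

text \<open>The index range in the definition of normal form. It lets finite and infinite cycles be
  enumerated uniformly.\<close>

definition index_set :: "nat set \<Rightarrow> nat set" where
  "index_set C = {j. enat j < cycle_length C}"

lemma index_set_eq: "index_set C = (if finite C then {..<card C} else UNIV)"
  by (auto simp: index_set_def cycle_length_def)

lemma index_set_down: "j \<in> index_set C \<Longrightarrow> i \<le> j \<Longrightarrow> i \<in> index_set C"
  by (auto simp: index_set_eq split: if_splits)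

lemma strict_mono_on_enumerate: "strict_mono_on (index_set C) (enumerate C)"
  by (auto simp: strict_mono_on_def index_set_eq split: if_splits)

lemma bij_betw_enumerate: "bij_betw (enumerate C) (index_set C) C"
  using bij_enumerate[of C] finite_bij_enumerate[of C] by (simp add: index_set_eq)

lemma enumerate_mem: "j \<in> index_set C \<Longrightarrow> enumerate C j \<in> C"
  using bij_betw_enumerate[of C] by (auto simp: bij_betw_def)

lemma le_enumerate_index: "j \<in> index_set C \<Longrightarrow> j \<le> enumerate C j"
  by (auto simp: index_set_eq le_enumerate finite_le_enumerate split: if_splits)

text \<open>Inverse of \<open>enumerate C\<close> on \<open>C\<close>. As a bounded count it is
  recursive when membership in \<open>C\<close> is decidable, and it can be evaluated at bounds
  outside \<open>C\<close>.\<close>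

definition rank :: "nat set \<Rightarrow> nat \<Rightarrow> nat" where
  "rank C x = card {z \<in> C. z < x}"

text \<open>The elements of \<open>C\<close> below \<open>c j\<close> are exactly the
  \<open>c i\<close> with \<open>i < j\<close>. Taking \<open>c\<close> arbitrary makes increasing
  enumerations unique: each one inverts \<open>rank C\<close>.\<close>

lemma rank_strict_mono_enumeration:
  assumes c: "bij_betw c (index_set C) C" "strict_mono_on (index_set C) c" and j: "j \<in> index_set C"
  shows "rank C (c j) = j"
proof -
  have lt: "c i < c j \<longleftrightarrow> i < j" if "i \<in> index_set C" for i
    using strict_mono_on_less[OF c(2) that j] .
  have "{z \<in> C. z < c j} = c ` {..<j}"
  proof (intro equalityI subsetI)
    fix z assume z: "z \<in> {z \<in> C. z < c j}"
    then obtain i where "i \<in> index_set C" "z = c i"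
      using c(1) by (auto simp: bij_betw_def)
    then show "z \<in> c ` {..<j}" using z lt by auto
  next
    fix z assume "z \<in> c ` {..<j}"
    then obtain i where i: "i < j" "z = c i" by auto
    then have "i \<in> index_set C" using index_set_down[OF j] by simp
    then show "z \<in> {z \<in> C. z < c j}"
      using lt i bij_betwE[OF c(1)] by auto
  qed
  moreover have "inj_on c {..<j}"
    using c(1) index_set_down[OF j] by (auto simp: bij_betw_def intro: inj_on_subset)
  ultimately show ?thesis by (simp add: rank_def card_image)
qed

lemma rank_enumerate: "j \<in> index_set C \<Longrightarrow> rank C (enumerate C j) = j"
  by (rule rank_strict_mono_enumeration[OF bij_betw_enumerate strict_mono_on_enumerate])

lemma obtain_index:
  assumes "x \<in> C"
  obtains j where "j \<in> index_set C" "x = enumerate C j"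
  using assms bij_betw_enumerate[of C] by (auto simp: bij_betw_def)

lemma enumerate_rank: "x \<in> C \<Longrightarrow> enumerate C (rank C x) = x"
  by (erule obtain_index) (simp add: rank_enumerate)

lemma rank_in_index_set: "x \<in> C \<Longrightarrow> rank C x \<in> index_set C"
  by (erule obtain_index) (simp add: rank_enumerate)

lemma strict_mono_enumeration_unique:
  assumes "bij_betw c (index_set C) C" "strict_mono_on (index_set C) c" "j \<in> index_set C"
  shows "c j = enumerate C j"
  using enumerate_rank[of "c j" C] rank_strict_mono_enumeration[OF assms] assms(1,3)
  by (simp add: bij_betwE)

section \<open>Normal permutations\<close>

lemma inv_delta_delta [simp]: "inv delta (delta k) = k"
  by (simp add: bij_delta bij_is_inj)

lemma delta_inv_delta [simp]: "delta (inv delta j) = j"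
  by (simp add: bij_delta bij_is_surj surj_f_inv_f)

lemma abs_le_delta: "\<bar>k\<bar> \<le> int (delta k)"
  by (simp add: delta_def)

text \<open>Odd codes stand for negative exponents and descend by two, even codes ascend by two.
  Truncated \<open>1 - 2 = 0\<close> matches the passage from exponent -1 to 0.\<close>

lemma delta_Suc: "delta (k + 1) = (if odd (delta k) then delta k - 2 else delta k + 2)"
proof -
  consider "k \<ge> 0" | "k = -1" | "k < -1" by linarith
  then show ?thesis
  proof cases
    case 1
    then obtain m where "k = int m" by (metis nonneg_int_cases)
    then show ?thesis by (auto simp: delta_def nat_add_distrib nat_mult_distrib)
  next
    case 3
    define m where "m = nat (- k - 2)"
    have "k = - int m - 2" using 3 by (simp add: m_def)
    moreover have "nat (3 + 2 * int m) = 2 * m + 3" "nat (1 + 2 * int m) = 2 * m + 1" by auto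
    ultimately show ?thesis by (simp add: delta_def)
  qed (simp add: delta_def)
qed

text \<open>Normality makes the left side increasing in \<open>j\<close>, hence injective. It
  exhausts \<open>C\<close> by counting if \<open>C\<close> is finite, and because
  \<open>delta\<close> codes every exponent otherwise; uniqueness of increasing enumerations
  finishes.\<close>

lemma cycle_normal_enumerate:
  assumes g: "bij g" and C: "C \<in> Part g" and norm: "cycle_normal g C" and j: "j \<in> index_set C"
  shows "perm_pow g (inv delta j) (LEAST a. a \<in> C) = enumerate C j"
proof -
  define a where "a = (LEAST a. a \<in> C)"
  let ?c = "\<lambda>j. perm_pow g (inv delta j) a"
  obtain x where x: "C = cycle_of g x" using C by (auto simp: Part_def)
  have "a \<in> C" unfolding a_def using self_in_cycle_of[of x g] x by (metis LeastI)
  then have C_eq: "C = cycle_of g a" using cycle_of_eq[OF g] x by simp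
  have mono: "strict_mono_on (index_set C) ?c"
    using norm unfolding cycle_normal_def Let_def a_def index_set_def .
  then have inj: "inj_on ?c (index_set C)" by (rule strict_mono_on_imp_inj_on)
  have sub: "?c ` index_set C \<subseteq> C" unfolding C_eq in_cycle_of_iff by (auto simp: in_cycle_of_iff)
  have "?c ` index_set C = C"
  proof (cases "finite C")
    case True
    then have "card (?c ` index_set C) = card C"
      using card_image[OF inj] by (simp add: index_set_eq)
    then show ?thesis by (rule card_subset_eq[OF True sub])
  next
    case False
    have "C \<subseteq> ?c ` UNIV"
    proof
      fix y assume "y \<in> C"
      then obtain k where "y = perm_pow g k a" unfolding C_eq in_cycle_of_iff by blast
      then show "y \<in> ?c ` UNIV" by (auto intro!: image_eqI[of _ _ "delta k"])
    qed
    then show ?thesis using sub False by (simp add: index_set_eq)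
  qed
  then have "bij_betw ?c (index_set C) C" using inj by (simp add: bij_betw_def)
  then show ?thesis
    using strict_mono_enumeration_unique[OF _ mono j] unfolding a_def by simp
qed

text \<open>Applying \<open>g\<close> raises the exponent by one, which \<open>delta_Suc\<close>
  translates to indices. The excluded indices are the even ones from which two steps leave the
  range; there the cycle closes up.\<close>

lemma normal_apply_enumerate:
  assumes g: "bij g" "normal g" and C: "C \<in> Part g"
    and j: "j \<in> index_set C" and j': "odd j \<or> j + 2 \<in> index_set C"
  shows "g (enumerate C j) = enumerate C (if odd j then j - 2 else j + 2)"
proof -
  have norm: "cycle_normal g C" using g(2) C by (simp add: normal_def)
  let ?a = "LEAST a. a \<in> C" and ?i = "if odd j then j - 2 else j + 2"
  have "?i \<in> index_set C" using j j' by (auto intro: index_set_down)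
  then have "perm_pow g (inv delta ?i) ?a = enumerate C ?i"
    by (rule cycle_normal_enumerate[OF g(1) C norm])
  moreover have "inv delta ?i = inv delta j + 1"
    using inv_delta_delta[of "inv delta j + 1"] by (simp only: delta_Suc delta_inv_delta)
  ultimately show ?thesis
    using perm_pow_Suc[OF g(1)] cycle_normal_enumerate[OF g(1) C norm j] by simp
qed

text \<open>The two normal permutations agree on all elements of a cycle except possibly one;
  injectivity then forces agreement there as well.\<close>

lemma normal_perm_unique:
  assumes g: "bij g" "normal g" and h: "bij h" "normal h" and eq: "Part_rel g = Part_rel h"
  shows "g = h"
proof
  fix x
  define C where "C = cycle_of g x"
  have C': "C = cycle_of h x"
    using Part_rel_Image[OF g(1)] Part_rel_Image[OF h(1)] eq by (simp add: C_def)
  have C_Part: "C \<in> Part g" "C \<in> Part h" using C_def C' by (auto simp: Part_def)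
  have xC: "x \<in> C" by (simp add: C_def self_in_cycle_of)
  obtain j where j: "j \<in> index_set C" "x = enumerate C j" using xC by (rule obtain_index)
  have agree: "g (enumerate C i) = h (enumerate C i)"
    if "i \<in> index_set C" "odd i \<or> i + 2 \<in> index_set C" for i
    using normal_apply_enumerate[OF g C_Part(1) that] normal_apply_enumerate[OF h C_Part(2) that]
    by simp
  show "g x = h x"
  proof (cases "odd j \<or> j + 2 \<in> index_set C")
    case True
    then show ?thesis using agree j by simp
  next
    case False
    have "h x \<in> C" using apply_in_cycle_of[OF h(1)] xC C' by simp
    \<comment> \<open>\<open>g\<close> permutes the cycle, so \<open>h x\<close> has a preimage
      \<open>y\<close> under \<open>g\<close> in \<open>C\<close>. It remains to identify
      \<open>y\<close> with \<open>x\<close>.\<close>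
    moreover have "bij_betw g C C"
    proof -
      have "g ` C = C"
      proof (intro equalityI subsetI)
        fix y assume "y \<in> C"
        then have "y \<in> cycle_of g x" by (simp add: C_def)
        then obtain k where "y = perm_pow g k x" by (auto simp: in_cycle_of_iff)
        then have "y = g (perm_pow g (k - 1) x)" using perm_pow_Suc[OF g(1), of "k - 1"] by simp
        moreover have "perm_pow g (k - 1) x \<in> C" by (auto simp: C_def in_cycle_of_iff)
        ultimately show "y \<in> g ` C" by blast
      qed (use apply_in_cycle_of[OF g(1)] C_def in auto)
      then show ?thesis using g(1) by (auto simp: bij_betw_def intro: inj_on_subset)
    qed
    ultimately obtain y where y: "y \<in> C" "g y = h x" by (metis bij_betw_imp_surj_on imageE)
    obtain i where i: "i \<in> index_set C" "y = enumerate C i" using y(1) by (rule obtain_index)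
    \<comment> \<open>If \<open>g\<close> and \<open>h\<close> are known to agree at
      \<open>y\<close>, then \<open>h y = h x\<close> and injectivity of \<open>h\<close> applies.
      Otherwise \<open>i\<close> and \<open>j\<close> are both the largest even index.\<close>
    have "i = j"
    proof (cases "odd i \<or> i + 2 \<in> index_set C")
      case True
      then have "h y = h x" using agree i y by simp
      then have "y = x" using h(1) by (simp add: bij_is_inj inj_eq)
      then show ?thesis using i j rank_enumerate by metis
    next
      case i': False
      then show ?thesis using False i(1) j(1) by (auto simp: index_set_eq elim!: evenE split: if_splits)
    qed
    then show ?thesis using y i j by simp
  qed
qed

section \<open>Decidability of the cycle relation of a normal permutation\<close>

text \<open>Counted from the least element of the cycle, \<open>x\<close> and \<open>y\<close> have
  exponents of absolute value at most \<open>x\<close> and \<open>y\<close>, so these differ by at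
  most \<open>x + y\<close>. Trying both directions covers either sign of the difference with
  forward iterates only.\<close>

lemma Part_rel_normal_iff:
  assumes g: "bij g" "normal g"
  shows "(x, y) \<in> Part_rel g \<longleftrightarrow> (\<exists>k<Suc (x + y). (g ^^ k) x = y \<or> (g ^^ k) y = x)"
proof
  assume xy: "(x, y) \<in> Part_rel g"
  define C where "C = cycle_of g x"
  have C: "C \<in> Part g" by (auto simp: C_def Part_def)
  define a where "a = (LEAST a. a \<in> C)"
  have norm: "cycle_normal g C" using g(2) C by (simp add: normal_def)
  have bound: "\<exists>p. z = perm_pow g p a \<and> \<bar>p\<bar> \<le> int z" if zC: "z \<in> C" for z
  proof -
    obtain j where j: "j \<in> index_set C" "z = enumerate C j" using zC by (rule obtain_index)
    have "z = perm_pow g (inv delta j) a"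
      using cycle_normal_enumerate[OF g(1) C norm j(1)] j(2) by (simp add: a_def)
    moreover have "\<bar>inv delta j\<bar> \<le> int z"
      using abs_le_delta[of "inv delta j"] le_enumerate_index[OF j(1)] j(2) by simp
    ultimately show ?thesis by blast
  qed
  have "x \<in> C" "y \<in> C" using xy Part_rel_iff[OF g(1)] by (auto simp: C_def self_in_cycle_of)
  then obtain p q where p: "x = perm_pow g p a" "\<bar>p\<bar> \<le> int x" and q: "y = perm_pow g q a" "\<bar>q\<bar> \<le> int y"
    using bound by metis
  have *: "(g ^^ nat (s - r)) (perm_pow g r a) = perm_pow g s a" if "r \<le> s" for r s
    using perm_pow_add[OF g(1), of "s - r" r a] that by (simp add: perm_pow_def)
  show "\<exists>k<Suc (x + y). (g ^^ k) x = y \<or> (g ^^ k) y = x"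
  proof (cases "p \<le> q")
    case True
    then show ?thesis using *[of p q] p q by (intro exI[of _ "nat (q - p)"]) auto
  next
    case False
    then show ?thesis using *[of q p] p q by (intro exI[of _ "nat (p - q)"]) auto
  qed
next
  have pow: "(z, (g ^^ k) z) \<in> Part_rel g" for k z
    by (simp add: Part_rel_iff[OF g(1)] funpow_in_cycle_of)
  assume "\<exists>k<Suc (x + y). (g ^^ k) x = y \<or> (g ^^ k) y = x"
  then show "(x, y) \<in> Part_rel g"
    using pow equiv_Part_rel[OF g(1)] by (metis equivE symD)
qed

lemma decidable_Part_rel_normal:
  assumes g: "bij g" "recursive g" "normal g"
  shows "decidable_rel (Part_rel g)"
  unfolding decidable_rel_iff_rec_pred Part_rel_normal_iff[OF g(1,3)]
  by (intro rec_pred_bex rec_fn_Suc rec_fn_add rec_pred_disj rec_pred_eq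
      rec_fn_funpow[OF g(2)[unfolded recursive_iff_rec_fn]] rec_fn_var0 rec_fn_var1 rec_fn_var2)

section \<open>The normal permutation of an equivalence relation\<close>

text \<open>The action of a normal cycle on indices. On a finite cycle \<open>{..<n}\<close> the largest even
  index is mapped to the largest odd one; truncated subtraction gives \<open>1 - 2 = 0\<close> and, when
  \<open>n = 1\<close>, \<open>0 - 1 = 0\<close>, as intended.\<close>

definition normal_step :: "nat set \<Rightarrow> nat \<Rightarrow> nat" where
  "normal_step J i = (if odd i then i - 2 else if i + 2 \<in> J then i + 2
     else if i + 1 \<in> J then i + 1 else i - 1)"

lemma bij_betw_normal_step: "bij_betw (normal_step (index_set C)) (index_set C) (index_set C)"
proof -
  define J where "J = index_set C"
  \<comment> \<open>The predecessor on indices: 0 comes from 1, or from itself in a one-element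
    cycle; the largest odd index comes from the largest even one, which is one above or one below
    it.\<close>
  let ?inv = "\<lambda>i. if even i then (if i \<ge> 2 then i - 2 else if 1 \<in> J then 1 else 0)
    else if i + 2 \<in> J then i + 2 else if i + 1 \<in> J then i + 1 else i - 1"
  have down: "\<And>i j. j \<in> J \<Longrightarrow> i \<le> j \<Longrightarrow> i \<in> J" unfolding J_def by (rule index_set_down)
  have J: "J = UNIV \<or> (\<exists>n. J = {..<n})" by (auto simp: J_def index_set_eq)
  have "bij_betw (normal_step J) J J"
  proof (rule bij_betw_byWitness[where f' = ?inv])
    show "\<forall>i\<in>J. ?inv (normal_step J i) = i"
      using J by (auto simp: normal_step_def elim!: evenE oddE)
    show "\<forall>i\<in>J. normal_step J (?inv i) = i"
      using J by (auto simp: normal_step_def elim!: evenE oddE) arith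
    show "normal_step J ` J \<subseteq> J"
      by (auto simp: normal_step_def intro: down)
    show "?inv ` J \<subseteq> J"
      by (auto intro: down)
  qed
  then show ?thesis by (simp add: J_def)
qed

definition normal_perm :: "(nat \<times> nat) set \<Rightarrow> nat \<Rightarrow> nat" where
  "normal_perm R x =
     enumerate (R `` {x}) (normal_step (index_set (R `` {x})) (rank (R `` {x}) x))"

lemma equiv_class_eq_Image:
  assumes "equiv UNIV R" "y \<in> R `` {x}"
  shows "R `` {y} = R `` {x}"
  using assms equiv_class_eq by fastforce

lemma normal_perm_enumerate:
  assumes "equiv UNIV R" "C = R `` {x}" "j \<in> index_set C"
  shows "normal_perm R (enumerate C j) = enumerate C (normal_step (index_set C) j)"
proof -
  have "R `` {enumerate C j} = C"
    using equiv_class_eq_Image[OF assms(1)] enumerate_mem[OF assms(3)] assms(2) by blast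
  then show ?thesis by (simp add: normal_perm_def rank_enumerate[OF assms(3)])
qed

text \<open>On a class, \<open>normal_perm R\<close> is \<open>normal_step\<close> conjugated by the
  increasing enumeration.\<close>

lemma bij_betw_normal_perm:
  assumes R: "equiv UNIV R" and C: "C = R `` {x}"
  shows "bij_betw (normal_perm R) C C"
proof -
  have "bij_betw (normal_perm R \<circ> enumerate C) (index_set C) C"
    using bij_betw_trans[OF bij_betw_normal_step bij_betw_enumerate]
    by (rule iffD1[OF bij_betw_cong, rotated]) (simp add: normal_perm_enumerate[OF R C])
  then show ?thesis using bij_betw_comp_iff[OF bij_betw_enumerate] by blast
qed

lemma normal_perm_rel:
  assumes "equiv UNIV R"
  shows "(x, normal_perm R x) \<in> R"
  using bij_betwE[OF bij_betw_normal_perm[OF assms refl]] equiv_class_self[OF assms, of x] by blast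

lemma bij_normal_perm:
  assumes R: "equiv UNIV R"
  shows "bij (normal_perm R)"
proof (rule bijI)
  show "inj (normal_perm R)"
  proof (rule injI)
    fix x y assume eq: "normal_perm R x = normal_perm R y"
    have "(x, y) \<in> R"
      using normal_perm_rel[OF R, of x] normal_perm_rel[OF R, of y] eq R
      by (metis equivE symD transD)
    then have "x \<in> R `` {x}" "y \<in> R `` {x}" using equiv_class_self[OF R] by auto
    then show "x = y"
      using bij_betw_normal_perm[OF R refl, of x] eq by (auto simp: bij_betw_def dest: inj_onD)
  qed
  show "surj (normal_perm R)"
    unfolding surj_def
  proof
    fix y
    have "y \<in> normal_perm R ` (R `` {y})"
      using bij_betw_normal_perm[OF R refl, of y] equiv_class_self[OF R, of y]
      by (simp add: bij_betw_def)
    then show "\<exists>x. y = normal_perm R x" by blast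
  qed
qed

text \<open>Induction on \<open>k\<close> away from 0. Codes closer to 0 stay in the range, so
  \<open>normal_step\<close> uses only its steps by two and never the closing branch.\<close>

lemma normal_perm_pow:
  assumes R: "equiv UNIV R" and C: "C = R `` {x}" and k: "delta k \<in> index_set C"
  shows "perm_pow (normal_perm R) k (enumerate C 0) = enumerate C (delta k)"
  using k
proof (induction k rule: int_induct[where k = 0])
  case base
  then show ?case by (simp add: delta_def)
next
  case (step1 k)
  have ev: "even (delta k)" using step1(1) by (simp add: delta_def even_nat_iff)
  then have "delta (k + 1) = delta k + 2" by (simp add: delta_Suc)
  moreover from this have "delta k \<in> index_set C" using step1.prems index_set_down by fastforce
  ultimately show ?case
    using step1 ev normal_perm_enumerate[OF R C, of "delta k"]
    by (simp add: perm_pow_Suc[OF bij_normal_perm[OF R]] normal_step_def)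
next
  case (step2 k)
  have odd: "odd (delta (k - 1))" using step2(1) by (simp add: delta_def even_nat_iff)
  then have dk: "delta k = delta (k - 1) - 2" using delta_Suc[of "k - 1"] by simp
  then have "delta k \<in> index_set C" using step2.prems index_set_down by (metis diff_le_self)
  \<comment> \<open>For negative exponents both sides are compared after one application of
    \<open>normal_perm R\<close>, which is then cancelled.\<close>
  then have "normal_perm R (perm_pow (normal_perm R) (k - 1) (enumerate C 0)) = enumerate C (delta k)"
    using step2(2) perm_pow_Suc[OF bij_normal_perm[OF R], of "k - 1"] by simp
  also have "\<dots> = normal_perm R (enumerate C (delta (k - 1)))"
    using normal_perm_enumerate[OF R C step2.prems] odd dk by (simp add: normal_step_def)
  finally show ?case using bij_normal_perm[OF R] by (simp add: bij_is_inj inj_eq)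
qed

text \<open>Every class element is a power applied to \<open>enumerate C 0\<close>, so a class lies
  in one cycle; conversely, the permutation and its inverse preserve classes.\<close>

lemma cycle_of_normal_perm:
  assumes R: "equiv UNIV R"
  shows "cycle_of (normal_perm R) x = R `` {x}"
proof
  define C where "C = R `` {x}"
  note g = bij_normal_perm[OF R]
  have xC: "x \<in> C" using equiv_class_self[OF R] by (simp add: C_def)
  have mem: "enumerate C j \<in> cycle_of (normal_perm R) (enumerate C 0)" if "j \<in> index_set C" for j
    using normal_perm_pow[OF R C_def, of "inv delta j"] that
    unfolding in_cycle_of_iff by (metis delta_inv_delta)
  have sub: "C \<subseteq> cycle_of (normal_perm R) (enumerate C 0)"
    using mem by (blast elim: obtain_index)
  then show "R `` {x} \<subseteq> cycle_of (normal_perm R) x"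
    using cycle_of_eq[OF g] xC by (auto simp: C_def)
  show "cycle_of (normal_perm R) x \<subseteq> R `` {x}"
  proof
    fix y assume "y \<in> cycle_of (normal_perm R) x"
    then obtain k where k: "y = perm_pow (normal_perm R) k x" by (auto simp: in_cycle_of_iff)
    have step: "(x, normal_perm R z) \<in> R \<longleftrightarrow> (x, z) \<in> R" for z
      using normal_perm_rel[OF R, of z] R by (meson equivE symD transD)
    have "(x, perm_pow (normal_perm R) k x) \<in> R"
    proof (induction k rule: int_induct[where k = 0])
      case base
      then show ?case using xC by (simp add: C_def)
    next
      case (step1 k)
      then show ?case by (simp add: perm_pow_Suc[OF g] step)
    next
      case (step2 k)
      then show ?case using perm_pow_Suc[OF g, of "k - 1" x] step by simp
    qed
    then show "y \<in> R `` {x}" using k by simp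
  qed
qed

lemma Part_rel_normal_perm:
  assumes "equiv UNIV R"
  shows "Part_rel (normal_perm R) = R"
  using Part_rel_iff[OF bij_normal_perm[OF assms]] cycle_of_normal_perm[OF assms] by auto

lemma normal_normal_perm:
  assumes R: "equiv UNIV R"
  shows "normal (normal_perm R)"
  unfolding normal_def
proof
  fix C assume "C \<in> Part (normal_perm R)"
  then obtain x where C: "C = R `` {x}"
    using cycle_of_normal_perm[OF R] by (auto simp: Part_def)
  have "strict_mono_on (index_set C)
    (\<lambda>j. perm_pow (normal_perm R) (inv delta j) (enumerate C 0))"
    using strict_mono_on_enumerate[of C]
    by (simp add: strict_mono_on_def normal_perm_pow[OF R C])
  \<comment> \<open>\<open>enumerate_0\<close> identifies the starting point with the least element
    of \<open>C\<close>.\<close>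
  then show "cycle_normal (normal_perm R) C"
    by (simp add: cycle_normal_def index_set_def enumerate_0)
qed

text \<open>Finiteness of a class is only semidecidable. However, the value at \<open>x\<close> needs only an
  initial segment \<open>{..<N}\<close> of the natural numbers that contains either two further elements of
  the class of \<open>x\<close> or the whole class, and the latter can be witnessed by a recursive
  permutation \<open>f\<close> with the given cycles. Such an \<open>N\<close> can be found by unbounded search.\<close>

definition segment_suffices :: "(nat \<times> nat) set \<Rightarrow> (nat \<Rightarrow> nat) \<Rightarrow> nat \<Rightarrow> nat \<Rightarrow> bool" where
  "segment_suffices R f N x \<longleftrightarrow> rank (R `` {x}) x + 2 < rank (R `` {x}) N \<or>
     (\<exists>m<N. (f ^^ Suc m) x = x \<and> (\<forall>i<Suc m. (f ^^ i) x < N))"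

text \<open>The listed iterates are closed under successor and predecessor: \<open>f\<close> leads
  from index \<open>m\<close> back to index 0.\<close>

lemma cycle_of_periodic:
  assumes f: "bij f" and m: "(f ^^ Suc m) x = x"
  shows "cycle_of f x = (\<lambda>i. (f ^^ i) x) ` {..<Suc m}" (is "_ = ?S")
proof
  have "perm_pow f k x \<in> ?S" for k
  proof (induction k rule: int_induct[where k = 0])
    case base
    show ?case by (auto intro!: image_eqI[of _ _ 0])
  next
    case (step1 k)
    then obtain i where i: "i < Suc m" "perm_pow f k x = (f ^^ i) x" by auto
    show ?case
    proof (cases "i = m")
      case True
      then show ?thesis using i m by (auto simp: perm_pow_Suc[OF f] intro!: image_eqI[of _ _ 0])
    next
      case False
      then show ?thesis using i by (auto simp: perm_pow_Suc[OF f] intro!: image_eqI[of _ _ "Suc i"])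
    qed
  next
    case (step2 k)
    then obtain i where i: "i < Suc m" "perm_pow f k x = (f ^^ i) x" by auto
    have eq: "f (perm_pow f (k - 1) x) = (f ^^ i) x" using i perm_pow_Suc[OF f, of "k - 1"] by simp
    show ?case
    proof (cases i)
      case 0
      then have "f (perm_pow f (k - 1) x) = f ((f ^^ m) x)" using eq m by simp
      then have "perm_pow f (k - 1) x = (f ^^ m) x" using f by (simp add: bij_is_inj inj_eq)
      then show ?thesis by auto
    next
      case (Suc l)
      then have "perm_pow f (k - 1) x = (f ^^ l) x" using eq f by (simp add: bij_is_inj inj_eq)
      then show ?thesis using Suc i by auto
    qed
  qed
  then show "cycle_of f x \<subseteq> ?S" by (auto simp: in_cycle_of_iff)
  show "?S \<subseteq> cycle_of f x"
    using funpow_in_cycle_of by auto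
qed

lemma ex_segment_suffices:
  assumes f: "bij f" and R: "Part_rel f = R"
  shows "\<exists>N. segment_suffices R f N x"
proof -
  define C where "C = R `` {x}"
  have C: "C = cycle_of f x" using Part_rel_Image[OF f] R by (simp add: C_def)
  show ?thesis
  proof (cases "finite C")
    case True
    have "\<not> inj (\<lambda>i. (f ^^ i) x)"
    proof
      assume "inj (\<lambda>i. (f ^^ i) x)"
      moreover have "range (\<lambda>i. (f ^^ i) x) \<subseteq> C"
        using funpow_in_cycle_of C by auto
      ultimately show False using True finite_imageD finite_subset infinite_UNIV_nat by blast
    qed
    then obtain i j where ij: "i < j" "(f ^^ i) x = (f ^^ j) x"
      unfolding inj_def by (metis linorder_neqE_nat)
    \<comment> \<open>A repetition among the iterates yields a return to \<open>x\<close> itself by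
      cancelling \<open>f ^^ i\<close>.\<close>
    then have "(f ^^ i) x = (f ^^ i) ((f ^^ (j - i)) x)"
      by (simp flip: funpow_add comp_apply[of "f ^^ i"])
    then have "(f ^^ (j - i)) x = x"
      using f by (metis bij_is_inj inj_fn inj_eq)
    then obtain m where m: "(f ^^ Suc m) x = x"
      using ij(1) by (metis Suc_diff_Suc)
    define S where "S = (\<lambda>i. (f ^^ i) x) ` {..<Suc m}"
    have "(f ^^ i) x \<le> Max S" if "i < Suc m" for i
      by (rule Max_ge) (use that in \<open>auto simp: S_def\<close>)
    then have "segment_suffices R f (Suc (m + Max S)) x"
      unfolding segment_suffices_def using m by (intro disjI2 exI[of _ m]) (auto simp: le_imp_less_Suc trans_le_add2)
    then show ?thesis ..
  next
    case False
    \<comment> \<open>The offset 3 makes the required inequality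
      \<open>rank C x + 2 < rank C ?N\<close> strict.\<close>
    let ?N = "enumerate C (rank C x + 3)"
    have "rank C ?N = rank C x + 3" using False by (intro rank_enumerate) (simp add: index_set_eq)
    then show ?thesis by (intro exI[of _ ?N]) (simp add: segment_suffices_def flip: C_def)
  qed
qed

text \<open>\<open>normal_step\<close> consults its set only at \<open>i + 1\<close> and
  \<open>i + 2\<close>. Either both sets contain \<open>i + 2\<close>, or the whole class lies below
  \<open>N\<close>, so that \<open>rank C N = card C\<close> and the sets coincide.\<close>

lemma normal_step_segment:
  assumes f: "bij f" and R: "Part_rel f = R" and N: "segment_suffices R f N x"
  shows "normal_step (index_set (R `` {x})) (rank (R `` {x}) x) =
    normal_step {..<rank (R `` {x}) N} (rank (R `` {x}) x)"
proof -
  define C where "C = R `` {x}"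
  have C: "C = cycle_of f x" using Part_rel_Image[OF f] R by (simp add: C_def)
  consider "rank C x + 2 < rank C N" | m where "(f ^^ Suc m) x = x" "\<forall>i<Suc m. (f ^^ i) x < N"
    using N unfolding segment_suffices_def by (auto simp: C_def)
  then have "normal_step (index_set C) (rank C x) = normal_step {..<rank C N} (rank C x)"
  proof cases
    case 1
    have "rank C N \<le> card C" if "finite C"
      unfolding rank_def using that by (auto intro: card_mono)
    then have "rank C x + 2 \<in> index_set C" using 1 by (auto simp: index_set_eq)
    then show ?thesis using 1 by (simp add: normal_step_def)
  next
    case 2
    have CN: "C \<subseteq> {..<N}" using 2 cycle_of_periodic[OF f 2(1)] C by auto
    then have "{z \<in> C. z < N} = C" by auto
    then show ?thesis using CN finite_subset[OF CN] by (simp add: index_set_eq rank_def)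
  qed
  then show ?thesis by (simp add: C_def)
qed

text \<open>Two unbounded searches: one for a sufficient segment, which fixes the target rank, and
  one for the class element of that rank.\<close>

lemma recursive_normal_perm:
  assumes R: "equiv UNIV R" "decidable_rel R" "permutable R"
  shows "recursive (normal_perm R)"
proof -
  obtain f where f: "bij f" "recursive f" "Part_rel f = R" using R(3) by (auto simp: permutable_def)
  define seg where "seg x = (LEAST N. segment_suffices R f N x)" for x
  have rank_rec: "rec_fn n (\<lambda>xs. rank (R `` {A xs}) (B xs))" if "rec_fn n A" "rec_fn n B" for n A B
  proof -
    have "rec_fn n (\<lambda>xs. card {k. k < B xs \<and> (A xs, k) \<in> R})"
      by (intro rec_fn_card rec_pred_rel[OF R(2)] rec_fn_tl rec_fn_var0 that)
    then show ?thesis by (simp add: rank_def conj_commute)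
  qed
  note intros = rank_rec rec_fn_var0 rec_fn_var1 rec_fn_var2 rec_fn_var3 rec_fn_const rec_fn_Suc
    rec_fn_add rec_fn_diff rec_pred_less rec_pred_eq rec_pred_conj rec_pred_disj rec_pred_odd
    rec_pred_bex rec_pred_ball rec_fn_funpow[OF f(2)[unfolded recursive_iff_rec_fn]]
    rec_fn_if rec_pred_rel[OF R(2)]
  have "rec_fn (Suc 0) (\<lambda>xs. LEAST N. segment_suffices R f N (hd xs))"
  proof (rule rec_fn_Least)
    \<comment> \<open>All quantifiers are bounded, and ranks and iterates of \<open>f\<close> are
      recursive.\<close>
    show "rec_pred (Suc (Suc 0)) (\<lambda>xs. segment_suffices R f (hd xs) (hd (tl xs)))"
      unfolding segment_suffices_def by (intro intros)
  qed (rule ex_segment_suffices[OF f(1,3)])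
  then have seg: "rec_fn n (\<lambda>xs. seg (A xs))" if "rec_fn n A" for n A
    unfolding seg_def using that by (rule rec_fn_compose1)
  \<comment> \<open>The element of the given rank is unique; \<open>LEAST\<close> puts it in the
    form required by \<open>rec_fn_Least\<close>.\<close>
  have spec: "normal_perm R x =
    (LEAST y. (x, y) \<in> R \<and>
       rank (R `` {x}) y = normal_step {..<rank (R `` {x}) (seg x)} (rank (R `` {x}) x))"
    and ex: "\<exists>y. (x, y) \<in> R \<and>
       rank (R `` {x}) y = normal_step {..<rank (R `` {x}) (seg x)} (rank (R `` {x}) x)" for x
  proof -
    define C where "C = R `` {x}"
    have "segment_suffices R f (seg x) x"
      unfolding seg_def using ex_segment_suffices[OF f(1,3)] by (rule LeastI_ex)
    then have step: "normal_step (index_set C) (rank C x) = normal_step {..<rank C (seg x)} (rank C x)"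
      unfolding C_def by (rule normal_step_segment[OF f(1,3)])
    have "normal_step (index_set C) (rank C x) \<in> index_set C"
      using bij_betwE[OF bij_betw_normal_step] rank_in_index_set equiv_class_self[OF R(1)]
      by (auto simp: C_def)
    then have *: "(x, y) \<in> R \<and> rank C y = normal_step {..<rank C (seg x)} (rank C x) \<longleftrightarrow>
      y = normal_perm R x" for y
      using enumerate_rank[of y C] rank_enumerate[of _ C] enumerate_mem[of _ C]
      unfolding normal_perm_def step[symmetric] C_def[symmetric] by (auto simp: C_def)
    show "normal_perm R x = (LEAST y. (x, y) \<in> R \<and>
       rank (R `` {x}) y = normal_step {..<rank (R `` {x}) (seg x)} (rank (R `` {x}) x))"
      "\<exists>y. (x, y) \<in> R \<and>
       rank (R `` {x}) y = normal_step {..<rank (R `` {x}) (seg x)} (rank (R `` {x}) x)"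
      using * unfolding C_def[symmetric] by (auto intro: Least_equality[symmetric])
  qed
  show ?thesis
    unfolding recursive_iff_rec_fn spec
  proof (rule rec_fn_Least)
    \<comment> \<open>Here \<open>hd xs\<close> is the candidate value and \<open>hd (tl xs)\<close>
      the argument. Membership in the initial segment unfolds to a comparison of recursive
      functions.\<close>
    show "rec_pred (Suc (Suc 0)) (\<lambda>xs. (hd (tl xs), hd xs) \<in> R \<and>
      rank (R `` {hd (tl xs)}) (hd xs) =
      normal_step {..<rank (R `` {hd (tl xs)}) (seg (hd (tl xs)))} (rank (R `` {hd (tl xs)}) (hd (tl xs))))"
      unfolding normal_step_def lessThan_iff by (intro intros seg)
  qed (rule ex)
qed

theorem theorem3p16:
  "bij_betw Part_rel
     {g :: nat \<Rightarrow> nat. bij g \<and> recursive g \<and> normal g}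
     {R :: (nat \<times> nat) set. equiv UNIV R \<and> decidable_rel R \<and> permutable R}"
proof (rule bij_betw_imageI)
  show "inj_on Part_rel {g. bij g \<and> recursive g \<and> normal g}"
    by (auto intro!: inj_onI intro: normal_perm_unique)
  show "Part_rel ` {g. bij g \<and> recursive g \<and> normal g} =
    {R. equiv UNIV R \<and> decidable_rel R \<and> permutable R}"
  proof (intro equalityI subsetI)
    fix R assume "R \<in> Part_rel ` {g. bij g \<and> recursive g \<and> normal g}"
    \<comment> \<open>Permutability is witnessed by the normal permutation itself.\<close>
    then show "R \<in> {R. equiv UNIV R \<and> decidable_rel R \<and> permutable R}"
      using equiv_Part_rel decidable_Part_rel_normal by (auto simp: permutable_def)
  next
    fix R :: "(nat \<times> nat) set"
    assume "R \<in> {R. equiv UNIV R \<and> decidable_rel R \<and> permutable R}"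
    then have R: "equiv UNIV R" "decidable_rel R" "permutable R" by auto
    have "R = Part_rel (normal_perm R)" using Part_rel_normal_perm[OF R(1)] by simp
    moreover have "normal_perm R \<in> {g. bij g \<and> recursive g \<and> normal g}"
      using bij_normal_perm[OF R(1)] recursive_normal_perm[OF R] normal_normal_perm[OF R(1)] by simp
    ultimately show "R \<in> Part_rel ` {g. bij g \<and> recursive g \<and> normal g}" by (rule image_eqI)
  qed
qed

end
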